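(* Let $V\cong\mathbb C^4$, let $\omega^1,\dots,\omega^4$ be any basis of $\Lambda^{1,0}V^*$, and let $\varphi^1=\omega^{12}$, $\varphi^2=\omega^{13}$, $\varphi^3=\omega^{14}$, $\varphi^4=\omega^{23}$, $\varphi^5=-\omega^{24}$, $\varphi^6=\omega^{34}$ be the induced basis of $\Lambda^{2,0}V^*$. Let $\Theta=\sum_{j,k=1}^6a_{j,k}\,\varphi^j\wedge\overline{\varphi^k}$ be a weakly positive $(2,2)$-form on $V$, with associated Hermitian $6\times6$ matrix $(a_{j,k})$. Then the anti-diagonal elements satisfy $$|a_{j,k}|\le\frac{a_{j,j}+a_{k,k}+a_{l,l}+a_{m,m}}{2}$$ for all $(j,k),(l,m)\in\{(1,6),(2,5),(3,4)\}$ with $(l,m)\ne(j,k)$. Moreover, this upper bound is sharp: for such $(j,k)$, $(l,m)$ there is a weakly positive $(2,2)$-form with $a_{j,k}\neq0$ for which equality holds.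
   Context: $\omega^{jk}=\omega^j\wedge\omega^k$. The volume form is $\mathrm{Vol}=\omega^1\wedge\omega^2\wedge\omega^3\wedge\omega^4\wedge\bar\omega^1\wedge\bar\omega^2\wedge\bar\omega^3\wedge\bar\omega^4$, and a $(4,4)$-form is non-negative if it is a non-negative real multiple of $\mathrm{Vol}$. A $(2,2)$-form is real if it equals its complex conjugate. A real $(2,2)$-form $\Theta$ is weakly positive if $\Theta\wedge\psi\wedge\bar\psi$ is non-negative for every decomposable $\psi\in\Lambda^{2,0}V^*$, i.e. every $\psi$ of the form $\mu_1\wedge\mu_2$ with $\mu_1,\mu_2\in\Lambda^{1,0}V^*$. *)

theory Defs
  imports Complex_Main "HOL-Library.Function_Algebras" "HOL-Library.Complex_Order"
begin

text \<open>
  Complex-valued forms on \<open>V\<close> are elements of the exterior algebra of the complexified real dual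
  of \<open>V\<close>, realised as functions on lists of vectors: a form of degree \<open>n\<close> vanishes on lists whose
  length is not \<open>n\<close>, and is an alternating, real-multilinear function of the entries of a list of
  length \<open>n\<close>. Addition and finite sums of forms are pointwise. The complex vector space \<open>V\<close> is given
  by a type together with its scalar multiplication \<open>scale\<close>.
\<close>

type_synonym 'v form = "'v list \<Rightarrow> complex"

definition fscale :: "complex \<Rightarrow> 'v form \<Rightarrow> 'v form" where
  "fscale c \<alpha> = (\<lambda>xs. c * \<alpha> xs)"

global_interpretation form: vector_space "fscale :: complex \<Rightarrow> 'v form \<Rightarrow> 'v form"
  defines form_span = form.span
    and form_dependent = form.dependent
  by standard (auto simp: fscale_def fun_eq_iff algebra_simps)

abbreviation form_independent :: "'v form set \<Rightarrow> bool" where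
  "form_independent S \<equiv> \<not> form_dependent S"

definition conj_form :: "'v form \<Rightarrow> 'v form" where
  "conj_form \<alpha> = (\<lambda>xs. cnj (\<alpha> xs))"

text \<open>
  The usual shuffle formula
  \[ (\alpha\wedge\beta)(x_1,\dots,x_{p+q}) =
     \sum_{\sigma} \mathrm{sgn}(\sigma)\,\alpha(x_{\sigma(1)},\dots,x_{\sigma(p)})\,
     \beta(x_{\sigma(p+1)},\dots,x_{\sigma(p+q)}), \]
  where \<open>\<sigma>\<close> runs over the \<open>(p,q)\<close>-shuffles. A shuffle is encoded by the set \<open>I\<close> of positions passed
  to \<open>\<alpha>\<close>, and its sign by the number of its inversions. Sets \<open>I\<close> whose cardinality is not the degree
  of \<open>\<alpha>\<close> do not contribute, so that no degrees need to be mentioned.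
\<close>

definition wedge :: "'v form \<Rightarrow> 'v form \<Rightarrow> 'v form"  (infixr "\<and>\<^sub>f" 70) where
  "\<alpha> \<and>\<^sub>f \<beta> = (\<lambda>xs. \<Sum>I\<in>Pow {..<length xs}.
     (- 1) ^ card {(i, j). i \<in> I \<and> j \<in> {..<length xs} - I \<and> j < i} *
     \<alpha> (nths xs I) * \<beta> (nths xs ({..<length xs} - I)))"

definition unit_form :: "'v form" where
  "unit_form = (\<lambda>xs. if xs = [] then 1 else 0)"

definition wedge_list :: "'v form list \<Rightarrow> 'v form" where
  "wedge_list \<alpha>s = foldr (\<and>\<^sub>f) \<alpha>s unit_form"

text \<open>The space of \<open>(1,0)\<close>-forms: the \<open>\<complex>\<close>-linear functionals on \<open>V\<close>.\<close>

definition Lambda10 :: "(complex \<Rightarrow> 'v::ab_group_add \<Rightarrow> 'v) \<Rightarrow> 'v form set" where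
  "Lambda10 scale = {\<mu>. Vector_Spaces.linear scale (*) (\<lambda>x. \<mu> [x]) \<and>
                        (\<forall>xs. length xs \<noteq> 1 \<longrightarrow> \<mu> xs = 0)}"

definition Lambda :: "(complex \<Rightarrow> 'v::ab_group_add \<Rightarrow> 'v) \<Rightarrow> nat \<Rightarrow> nat \<Rightarrow> 'v form set" where
  "Lambda scale p q = form_span {wedge_list \<mu>s \<and>\<^sub>f conj_form (wedge_list \<nu>s) | \<mu>s \<nu>s.
     length \<mu>s = p \<and> set \<mu>s \<subseteq> Lambda10 scale \<and> length \<nu>s = q \<and> set \<nu>s \<subseteq> Lambda10 scale}"

definition Lambda10_basis ::
  "(complex \<Rightarrow> 'v::ab_group_add \<Rightarrow> 'v) \<Rightarrow> (nat \<Rightarrow> 'v form) \<Rightarrow> bool" where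
  "Lambda10_basis scale \<omega> \<longleftrightarrow>
     inj_on \<omega> {1..4} \<and> form_independent (\<omega> ` {1..4}) \<and> form_span (\<omega> ` {1..4}) = Lambda10 scale"

definition Vol :: "(nat \<Rightarrow> 'v form) \<Rightarrow> 'v form" where
  "Vol \<omega> = \<omega> 1 \<and>\<^sub>f \<omega> 2 \<and>\<^sub>f \<omega> 3 \<and>\<^sub>f \<omega> 4 \<and>\<^sub>f
           conj_form (\<omega> 1) \<and>\<^sub>f conj_form (\<omega> 2) \<and>\<^sub>f conj_form (\<omega> 3) \<and>\<^sub>f conj_form (\<omega> 4)"

definition nonneg44 :: "(nat \<Rightarrow> 'v form) \<Rightarrow> 'v form \<Rightarrow> bool" where
  "nonneg44 \<omega> \<alpha> \<longleftrightarrow> (\<exists>r::real. r \<ge> 0 \<and> \<alpha> = fscale (complex_of_real r) (Vol \<omega>))"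

definition decomposable20 :: "(complex \<Rightarrow> 'v::ab_group_add \<Rightarrow> 'v) \<Rightarrow> 'v form set" where
  "decomposable20 scale = {\<mu>1 \<and>\<^sub>f \<mu>2 | \<mu>1 \<mu>2. \<mu>1 \<in> Lambda10 scale \<and> \<mu>2 \<in> Lambda10 scale}"

text \<open>
  Non-negativity refers to the volume form of the basis \<open>\<omega>\<close>; another basis changes that volume form
  by a positive factor only.
\<close>

definition weakly_positive ::
  "(complex \<Rightarrow> 'v::ab_group_add \<Rightarrow> 'v) \<Rightarrow> (nat \<Rightarrow> 'v form) \<Rightarrow> 'v form \<Rightarrow> bool" where
  "weakly_positive scale \<omega> \<Theta> \<longleftrightarrow>
     \<Theta> \<in> Lambda scale 2 2 \<and> conj_form \<Theta> = \<Theta> \<and>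
     (\<forall>\<psi>\<in>decomposable20 scale. nonneg44 \<omega> (\<Theta> \<and>\<^sub>f \<psi> \<and>\<^sub>f conj_form \<psi>))"

definition phi :: "(nat \<Rightarrow> 'v form) \<Rightarrow> nat \<Rightarrow> 'v form" where
  "phi \<omega> j =
     (if j = 1 then \<omega> 1 \<and>\<^sub>f \<omega> 2
      else if j = 2 then \<omega> 1 \<and>\<^sub>f \<omega> 3
      else if j = 3 then \<omega> 1 \<and>\<^sub>f \<omega> 4
      else if j = 4 then \<omega> 2 \<and>\<^sub>f \<omega> 3
      else if j = 5 then - (\<omega> 2 \<and>\<^sub>f \<omega> 4)
      else if j = 6 then \<omega> 3 \<and>\<^sub>f \<omega> 4
      else 0)"

definition form22 :: "(nat \<Rightarrow> 'v form) \<Rightarrow> (nat \<Rightarrow> nat \<Rightarrow> complex) \<Rightarrow> 'v form" where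
  "form22 \<omega> a = (\<Sum>j=1..6. \<Sum>k=1..6. fscale (a j k) (phi \<omega> j \<and>\<^sub>f conj_form (phi \<omega> k)))"

definition antidiag :: "(nat \<times> nat) set" where
  "antidiag = {(1, 6), (2, 5), (3, 4)}"

end

theory Submission
  imports Defs
begin

text \<open>
  Write \<open>\<psi> = \<Sum> c\<^sub>p \<phi>\<^sup>p\<close>. The basis of (2,0)-forms is chosen such that \<open>\<phi>\<^sup>p \<and> \<phi>\<^sup>q\<close> is
  \<open>\<omega>\<^sup>1 \<and> \<omega>\<^sup>2 \<and> \<omega>\<^sup>3 \<and> \<omega>\<^sup>4\<close> when \<open>p + q = 7\<close> and zero otherwise (\<open>phi_wedge_phi\<close>). Forms of degree two
  commute, hence \<open>\<Theta> \<and> \<psi> \<and> conj_form \<psi>\<close> is \<open>Vol\<close> times the value at \<open>b\<^sub>p = c\<^bsub>7-p\<^esub>\<close> of the sesquilinear form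
  \<open>H(b) = \<Sum> a\<^bsub>p,q\<^esub> b\<^sub>p cnj b\<^sub>q\<close> (\<open>form22_wedge_square\<close>). The form \<open>\<psi>\<close> is decomposable exactly when its
  coordinates satisfy the Pluecker relation \<open>c\<^sub>1 c\<^sub>6 + c\<^sub>2 c\<^sub>5 + c\<^sub>3 c\<^sub>4 = 0\<close>, that is, when \<open>c\<close>, or equivalently
  \<open>b\<close>, lies on the Klein quadric (\<open>decomposable20_iff\<close>). As \<open>Vol\<close> does not vanish, weak positivity of a real form says
  that \<open>H\<close> is non-negative on the Klein quadric (\<open>weakly_positive_form22D\<close>, \<open>weakly_positive_form22I\<close>), and the
  theorem becomes a statement about \<open>H\<close>.

  For the bound, take two of the pairs (1,6), (2,5), (3,4), say \<open>(j,k)\<close> and \<open>(l,m)\<close>. For unit complex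
  numbers \<open>u\<close> and \<open>t\<close> the point with coordinates \<open>b\<^sub>j = u\<close>, \<open>b\<^sub>k = 1\<close>, \<open>b\<^sub>l = t\<close>, \<open>b\<^sub>m = - u cnj t\<close> and zeros
  elsewhere is on the quadric. Averaging \<open>H\<close> over the four values \<open>t = 1, i, -1, -i\<close> removes all entries
  that couple \<open>{j,k}\<close> with \<open>{l,m}\<close> and also \<open>a\<^bsub>l,m\<^esub>\<close>, \<open>a\<^bsub>m,l\<^esub>\<close>, because they come with the factors \<open>t\<close>,
  \<open>cnj t\<close>, \<open>t\<^sup>2\<close>, \<open>(cnj t)\<^sup>2\<close>. What remains is
  \<open>0 \<le> a\<^bsub>j,j\<^esub> + a\<^bsub>k,k\<^esub> + a\<^bsub>l,l\<^esub> + a\<^bsub>m,m\<^esub> + a\<^bsub>j,k\<^esub> u + a\<^bsub>k,j\<^esub> cnj u\<close>, and the phase of \<open>u\<close> can be chosen to turn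
  the last two terms into \<open>-2 |a\<^bsub>j,k\<^esub>|\<close> (\<open>klein_hermitian_average\<close>, \<open>antidiagonal_bound\<close>).

  Equality holds for the permutation matrix of the transposition of \<open>j\<close> and \<open>k\<close>. There
  \<open>H(b) = 2 Re (b\<^sub>j cnj b\<^sub>k) + \<Sum> |b\<^sub>p|\<^sup>2\<close>, the sum running over the other four indices; on the quadric
  \<open>|b\<^sub>j b\<^sub>k|\<close> is at most the sum of the two other products \<open>|b\<^sub>l b\<^sub>m|\<close>, and the arithmetic-geometric mean
  inequality gives \<open>H(b) \<ge> 0\<close> (\<open>swap_matrix_nonneg\<close>).

  The exterior algebra rests on one identity (\<open>wedge_Cons\<close>): inserting a vector in the first place is an
  antiderivation of the wedge product. Associativity and graded commutativity follow from it by induction on the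
  list of arguments.
\<close>

section \<open>The shuffle product on graded functions of lists\<close>

definition homogeneous :: "nat \<Rightarrow> 'v form \<Rightarrow> bool" where
  "homogeneous n \<alpha> \<longleftrightarrow> (\<forall>xs. length xs \<noteq> n \<longrightarrow> \<alpha> xs = 0)"

definition contract :: "'v \<Rightarrow> 'v form \<Rightarrow> 'v form" where
  "contract x \<alpha> = (\<lambda>xs. \<alpha> (x # xs))"

text \<open>
  The sign that an antiderivation of odd degree picks up when it passes \<open>\<alpha>\<close>. Taking the parity from the
  length of the argument list defines it for \<open>\<alpha>\<close> of mixed degree, so that the rules below hold for
  arbitrary functions on lists.
\<close>

definition parity_twist :: "'v form \<Rightarrow> 'v form" where
  "parity_twist \<alpha> = (\<lambda>xs. (- 1) ^ length xs * \<alpha> xs)"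

text \<open>
  The first position of a list \<open>x # xs\<close> is passed either to the left or to the right factor. This and the next
  two lemmas compare the sets of positions, and the inversion counts, for \<open>x # xs\<close> and for \<open>xs\<close>.
\<close>

lemma Pow_lessThan_Suc_shift:
  "Pow {..<Suc n} = (\<lambda>I. insert 0 (Suc ` I)) ` Pow {..<n} \<union> (`) Suc ` Pow {..<n}"
proof -
  have "I \<in> (\<lambda>I. insert 0 (Suc ` I)) ` Pow {..<n} \<union> (`) Suc ` Pow {..<n}"
    if I: "I \<in> Pow {..<Suc n}" for I
  proof -
    define J where "J = {i. Suc i \<in> I}"
    have J: "J \<in> Pow {..<n}" using I by (auto simp: J_def)
    have "I = (if 0 \<in> I then insert 0 (Suc ` J) else Suc ` J)"
      by (auto simp: J_def image_iff) (metis not0_implies_Suc)+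
    with J show ?thesis by (metis UnI1 UnI2 image_eqI)
  qed
  then show ?thesis by auto
qed

text \<open>The position 0 in \<open>I\<close> has nothing before it, hence it creates no inversion.\<close>

lemma card_inversions_shift_left:
  "card {(i, j). i \<in> insert 0 (Suc ` I) \<and> j \<in> {..<Suc n} - insert 0 (Suc ` I) \<and> j < i} =
   card {(i, j). i \<in> I \<and> j \<in> {..<n} - I \<and> j < i}"
proof -
  have "{(i, j). i \<in> insert 0 (Suc ` I) \<and> j \<in> {..<Suc n} - insert 0 (Suc ` I) \<and> j < i} =
      map_prod Suc Suc ` {(i, j). i \<in> I \<and> j \<in> {..<n} - I \<and> j < i}" (is "?A = ?B")
  proof
    show "?A \<subseteq> ?B"
    proof
      fix z assume z: "z \<in> ?A"
      then obtain i j where ij: "z = (i, j)" "i \<in> insert 0 (Suc ` I)"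
        "j \<in> {..<Suc n} - insert 0 (Suc ` I)" "j < i" by auto
      then obtain i' where i': "i = Suc i'" "i' \<in> I" by auto
      from ij obtain j' where j': "j = Suc j'" by (cases j) auto
      show "z \<in> ?B" using ij i' j' by (auto simp: image_iff)
    qed
  qed auto
  then show ?thesis
    by (simp add: card_image inj_on_subset[OF prod.inj_map[OF inj_Suc inj_Suc]])
qed

text \<open>
  The position 0 outside of \<open>I\<close> forms an inversion with each element of \<open>I\<close>. This is where the sign
  \<open>parity_twist\<close> comes from.
\<close>

lemma card_inversions_shift_right:
  assumes "I \<subseteq> {..<n}"
  shows "card {(i, j). i \<in> Suc ` I \<and> j \<in> {..<Suc n} - Suc ` I \<and> j < i} =
    card I + card {(i, j). i \<in> I \<and> j \<in> {..<n} - I \<and> j < i}"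
proof -
  let ?C = "{(i, j). i \<in> I \<and> j \<in> {..<n} - I \<and> j < i}"
  have fin: "finite I" using assms finite_subset by blast
  have finC: "finite ?C" by (rule finite_subset[of _ "I \<times> {..<n}"]) (auto simp: fin)
  have "{(i, j). i \<in> Suc ` I \<and> j \<in> {..<Suc n} - Suc ` I \<and> j < i} =
      (\<lambda>i. (Suc i, 0)) ` I \<union> map_prod Suc Suc ` ?C" (is "?A = ?B")
  proof
    show "?A \<subseteq> ?B"
    proof
      fix z assume z: "z \<in> ?A"
      then obtain i j where ij: "z = (Suc i, j)" "i \<in> I"
        "j \<in> {..<Suc n} - Suc ` I" "j < Suc i" by auto
      then show "z \<in> ?B" by (cases j) (auto simp: image_iff)
    qed
  qed auto
  moreover have "finite (map_prod Suc Suc ` ?C)" using finC by (rule finite_imageI)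
  then have "card ((\<lambda>i. (Suc i, 0::nat)) ` I \<union> map_prod Suc Suc ` ?C) = card I + card ?C"
    by (subst card_Un_disjoint)
      (auto simp: fin finC card_image inj_on_def inj_on_subset[OF prod.inj_map[OF inj_Suc inj_Suc]])
  ultimately show ?thesis by simp
qed

lemma wedge_Nil [simp]: "(\<alpha> \<and>\<^sub>f \<beta>) [] = \<alpha> [] * \<beta> []"
  by (simp add: wedge_def)

text \<open>
  The recursion on which all of the exterior algebra below is based: the two terms collect the shuffles that
  pass \<open>x\<close> to \<open>\<alpha>\<close> and to \<open>\<beta>\<close>, respectively.
\<close>

lemma wedge_Cons:
  "(\<alpha> \<and>\<^sub>f \<beta>) (x # xs) =
    (contract x \<alpha> \<and>\<^sub>f \<beta>) xs + (parity_twist \<alpha> \<and>\<^sub>f contract x \<beta>) xs"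
proof -
  let ?n = "length xs"
  let ?t = "\<lambda>I. (- 1) ^ card {(i, j). i \<in> I \<and> j \<in> {..<Suc ?n} - I \<and> j < i} *
     \<alpha> (nths (x # xs) I) * \<beta> (nths (x # xs) ({..<Suc ?n} - I))"
  have inj1: "inj_on (\<lambda>I. insert 0 (Suc ` I)) (Pow {..<?n})"
    by (rule inj_onI) (auto simp: insert_ident inj_image_eq_iff)
  have inj2: "inj_on ((`) Suc) (Pow {..<?n})"
    by (rule inj_onI) (auto simp: inj_image_eq_iff)
  have "(\<alpha> \<and>\<^sub>f \<beta>) (x # xs) = (\<Sum>I\<in>Pow {..<Suc ?n}. ?t I)"
    by (simp add: wedge_def)
  also have "\<dots> = (\<Sum>I\<in>(\<lambda>I. insert 0 (Suc ` I)) ` Pow {..<?n}. ?t I) +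
      (\<Sum>I\<in>(`) Suc ` Pow {..<?n}. ?t I)"
    unfolding Pow_lessThan_Suc_shift by (rule sum.union_disjoint) auto
  also have "(\<Sum>I\<in>(\<lambda>I. insert 0 (Suc ` I)) ` Pow {..<?n}. ?t I) =
      (contract x \<alpha> \<and>\<^sub>f \<beta>) xs"
    unfolding sum.reindex[OF inj1] wedge_def o_def
  proof (rule sum.cong)
    fix I assume "I \<in> Pow {..<?n}"
    have "{j. Suc j < Suc ?n \<and> Suc j \<notin> Suc ` I} = {..<?n} - I" by auto
    then show "?t (insert 0 (Suc ` I)) =
      (- 1) ^ card {(i, j). i \<in> I \<and> j \<in> {..<?n} - I \<and> j < i} *
        contract x \<alpha> (nths xs I) * \<beta> (nths xs ({..<?n} - I))"
      unfolding card_inversions_shift_left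
      by (auto simp: nths_Cons contract_def inj_image_mem_iff intro!: arg_cong[where f = \<beta>] arg_cong[where f = "nths xs"])
  qed simp
  also have "(\<Sum>I\<in>(`) Suc ` Pow {..<?n}. ?t I) = (parity_twist \<alpha> \<and>\<^sub>f contract x \<beta>) xs"
    unfolding sum.reindex[OF inj2] wedge_def o_def
  proof (rule sum.cong)
    fix I assume I: "I \<in> Pow {..<?n}"
    have "{j. Suc j < Suc ?n \<and> Suc j \<notin> Suc ` I} = {..<?n} - I" by auto
    moreover have "length (nths xs I) = card I"
      using I by (auto simp: length_nths intro!: arg_cong[where f = card])
    ultimately show "?t (Suc ` I) =
      (- 1) ^ card {(i, j). i \<in> I \<and> j \<in> {..<?n} - I \<and> j < i} *
        parity_twist \<alpha> (nths xs I) * contract x \<beta> (nths xs ({..<?n} - I))"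
      using I unfolding card_inversions_shift_right[OF PowD[OF I]]
      by (auto simp: nths_Cons contract_def parity_twist_def inj_image_mem_iff power_add
          intro!: arg_cong[where f = \<beta>] arg_cong[where f = "nths xs"])
  qed simp
  finally show ?thesis .
qed

lemma wedge_add_left: "(\<alpha> + \<alpha>') \<and>\<^sub>f \<beta> = \<alpha> \<and>\<^sub>f \<beta> + \<alpha>' \<and>\<^sub>f \<beta>"
  by (auto simp: wedge_def fun_eq_iff algebra_simps sum.distrib)

lemma wedge_add_right: "\<beta> \<and>\<^sub>f (\<alpha> + \<alpha>') = \<beta> \<and>\<^sub>f \<alpha> + \<beta> \<and>\<^sub>f \<alpha>'"
  by (auto simp: wedge_def fun_eq_iff algebra_simps sum.distrib)

lemma wedge_fscale_left: "fscale c \<alpha> \<and>\<^sub>f \<beta> = fscale c (\<alpha> \<and>\<^sub>f \<beta>)"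
  by (auto simp: wedge_def fscale_def fun_eq_iff algebra_simps sum_distrib_left)

lemma wedge_fscale_right: "\<alpha> \<and>\<^sub>f fscale c \<beta> = fscale c (\<alpha> \<and>\<^sub>f \<beta>)"
  by (auto simp: wedge_def fscale_def fun_eq_iff algebra_simps sum_distrib_left)

lemma wedge_zero_left [simp]: "0 \<and>\<^sub>f \<beta> = 0"
  by (auto simp: wedge_def fun_eq_iff)

lemma wedge_zero_right [simp]: "\<beta> \<and>\<^sub>f 0 = 0"
  by (auto simp: wedge_def fun_eq_iff)

lemma fscale_minus_one: "fscale (- 1) \<alpha> = - \<alpha>"
  by (simp add: fscale_def fun_eq_iff)

lemma wedge_minus_left: "(- \<alpha>) \<and>\<^sub>f \<beta> = - (\<alpha> \<and>\<^sub>f \<beta>)"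
  by (metis fscale_minus_one wedge_fscale_left)

lemma wedge_minus_right: "\<alpha> \<and>\<^sub>f (- \<beta>) = - (\<alpha> \<and>\<^sub>f \<beta>)"
  by (metis fscale_minus_one wedge_fscale_right)

lemma wedge_sum_left: "(\<Sum>i\<in>A. f i) \<and>\<^sub>f \<beta> = (\<Sum>i\<in>A. f i \<and>\<^sub>f \<beta>)"
  by (induction A rule: infinite_finite_induct) (simp_all only: wedge_add_left sum.infinite sum.empty sum.insert wedge_zero_left simp_thms)

lemma wedge_sum_right: "\<beta> \<and>\<^sub>f (\<Sum>i\<in>A. f i) = (\<Sum>i\<in>A. \<beta> \<and>\<^sub>f f i)"
  by (induction A rule: infinite_finite_induct) (simp_all only: wedge_add_right sum.infinite sum.empty sum.insert wedge_zero_right simp_thms)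

lemma contract_wedge:
  "contract x (\<alpha> \<and>\<^sub>f \<beta>) = contract x \<alpha> \<and>\<^sub>f \<beta> + parity_twist \<alpha> \<and>\<^sub>f contract x \<beta>"
  by (simp add: contract_def[of x "\<alpha> \<and>\<^sub>f \<beta>"] wedge_Cons fun_eq_iff)

lemma contract_parity_twist: "contract x (parity_twist \<alpha>) = - parity_twist (contract x \<alpha>)"
  by (simp add: contract_def parity_twist_def fun_eq_iff)

lemma parity_twist_add: "parity_twist (\<alpha> + \<beta>) = parity_twist \<alpha> + parity_twist \<beta>"
  by (simp add: parity_twist_def fun_eq_iff algebra_simps)

lemma parity_twist_wedge_apply:
  "parity_twist (\<alpha> \<and>\<^sub>f \<beta>) xs = (parity_twist \<alpha> \<and>\<^sub>f parity_twist \<beta>) xs"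
proof (induction xs arbitrary: \<alpha> \<beta>)
  case Nil
  show ?case by (simp add: parity_twist_def)
next
  case (Cons x xs)
  have "parity_twist (\<alpha> \<and>\<^sub>f \<beta>) (x # xs) = - parity_twist (contract x (\<alpha> \<and>\<^sub>f \<beta>)) xs"
    by (simp add: parity_twist_def contract_def)
  also have "\<dots> = (parity_twist \<alpha> \<and>\<^sub>f parity_twist \<beta>) (x # xs)"
    unfolding wedge_Cons contract_wedge contract_parity_twist parity_twist_add
    by (simp add: Cons.IH wedge_minus_left wedge_minus_right)
  finally show ?case .
qed

lemma parity_twist_wedge: "parity_twist (\<alpha> \<and>\<^sub>f \<beta>) = parity_twist \<alpha> \<and>\<^sub>f parity_twist \<beta>"
  by (rule ext) (rule parity_twist_wedge_apply)

text \<open>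
  Contracting either bracketing gives the same three terms, with \<open>x\<close> passed to \<open>\<alpha>\<close>, to \<open>\<beta>\<close> or to \<open>\<gamma>\<close>, up to the
  bracketing of shorter products; the sign in the third term is multiplicative by \<open>parity_twist_wedge\<close>.
\<close>

lemma wedge_assoc_apply: "((\<alpha> \<and>\<^sub>f \<beta>) \<and>\<^sub>f \<gamma>) xs = (\<alpha> \<and>\<^sub>f \<beta> \<and>\<^sub>f \<gamma>) xs"
proof (induction xs arbitrary: \<alpha> \<beta> \<gamma>)
  case (Cons x xs)
  show ?case
    by (simp add: wedge_Cons contract_wedge parity_twist_wedge wedge_add_left wedge_add_right Cons.IH)
qed simp

lemma wedge_assoc: "(\<alpha> \<and>\<^sub>f \<beta>) \<and>\<^sub>f \<gamma> = \<alpha> \<and>\<^sub>f \<beta> \<and>\<^sub>f \<gamma>"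
  by (rule ext) (rule wedge_assoc_apply)

lemma wedge_unit_right [simp]: "\<alpha> \<and>\<^sub>f unit_form = \<alpha>"
proof
  fix xs show "(\<alpha> \<and>\<^sub>f unit_form) xs = \<alpha> xs"
  proof (induction xs arbitrary: \<alpha>)
    case (Cons x xs)
    have "contract x unit_form = 0" by (simp add: contract_def unit_form_def fun_eq_iff)
    then show ?case by (simp add: wedge_Cons Cons.IH) (simp add: contract_def)
  qed (simp add: unit_form_def)
qed

lemma homogeneous_parity_twist: "homogeneous p \<alpha> \<Longrightarrow> parity_twist \<alpha> = fscale ((- 1) ^ p) \<alpha>"
  by (auto simp: homogeneous_def parity_twist_def fscale_def fun_eq_iff)

lemma homogeneous_contract: "homogeneous (Suc p) \<alpha> \<Longrightarrow> homogeneous p (contract x \<alpha>)"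
  by (auto simp: homogeneous_def contract_def)

lemma homogeneous_0_contract: "homogeneous 0 \<alpha> \<Longrightarrow> contract x \<alpha> = 0"
  by (auto simp: homogeneous_def contract_def fun_eq_iff)

lemma neg_one_power_Suc_mult:
  "(- 1) ^ (Suc p * q) * (- 1) ^ q = ((- 1) ^ (p * q) :: complex)"
  by (simp add: minus_one_power_iff)

text \<open>
  Both \<open>\<alpha> \<and> \<beta>\<close> and \<open>\<beta> \<and> \<alpha>\<close> contract to one term with \<open>x\<close> in \<open>\<alpha>\<close> and one with \<open>x\<close> in \<open>\<beta>\<close>. Passing \<open>x\<close> to a factor
  lowers its degree by one, and the resulting change of \<open>(- 1) ^ (p * q)\<close> is the sign from \<open>parity_twist\<close>.
\<close>

lemma wedge_graded_commute_apply:
  assumes "homogeneous p \<alpha>" "homogeneous q \<beta>"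
  shows "(\<alpha> \<and>\<^sub>f \<beta>) xs = (- 1) ^ (p * q) * (\<beta> \<and>\<^sub>f \<alpha>) xs"
  using assms
proof (induction xs arbitrary: p \<alpha> q \<beta>)
  case Nil
  then show ?case by (cases "p = 0"; cases "q = 0") (auto simp: homogeneous_def)
next
  case (Cons x xs)
  note ph = Cons.prems
  have A: "(contract x \<alpha> \<and>\<^sub>f \<beta>) xs = (- 1) ^ (p * q) * (- 1) ^ q * (\<beta> \<and>\<^sub>f contract x \<alpha>) xs"
  proof (cases p)
    case 0
    then show ?thesis using ph by (simp add: homogeneous_0_contract)
  next
    case (Suc p')
    then have "homogeneous p' (contract x \<alpha>)" using ph(1) by (simp add: homogeneous_contract)
    from Cons.IH[OF this ph(2)] show ?thesis
      unfolding Suc neg_one_power_Suc_mult .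
  qed
  have B: "(\<alpha> \<and>\<^sub>f contract x \<beta>) xs = (- 1) ^ (p * q) * (- 1) ^ p * (contract x \<beta> \<and>\<^sub>f \<alpha>) xs"
  proof (cases q)
    case 0
    then show ?thesis using ph by (simp add: homogeneous_0_contract)
  next
    case (Suc q')
    then have "homogeneous q' (contract x \<beta>)" using ph(2) by (simp add: homogeneous_contract)
    from Cons.IH[OF ph(1) this] show ?thesis
      unfolding Suc mult.commute[of p] neg_one_power_Suc_mult .
  qed
  \<comment> \<open>each of the two signs in \<open>A\<close> and \<open>B\<close> meets itself in the recursion for \<open>\<beta> \<and> \<alpha>\<close>\<close>
  have sq: "(- 1) ^ n * ((- 1) ^ n * z) = z" for n and z :: complex
    by (simp add: minus_one_power_iff)
  show ?case
    unfolding wedge_Cons homogeneous_parity_twist[OF ph(1)] homogeneous_parity_twist[OF ph(2)]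
      wedge_fscale_left
    unfolding fscale_def A B by (simp add: algebra_simps sq)
qed

lemma wedge_graded_commute:
  assumes "homogeneous p \<alpha>" "homogeneous q \<beta>"
  shows "\<alpha> \<and>\<^sub>f \<beta> = fscale ((- 1) ^ (p * q)) (\<beta> \<and>\<^sub>f \<alpha>)"
  by (rule ext) (simp add: fscale_def wedge_graded_commute_apply[OF assms])

lemma homogeneous_wedge:
  assumes "homogeneous p \<alpha>" "homogeneous q \<beta>"
  shows "homogeneous (p + q) (\<alpha> \<and>\<^sub>f \<beta>)"
  unfolding homogeneous_def
proof (intro allI impI)
  fix xs :: "'a list"
  assume "length xs \<noteq> p + q"
  then show "(\<alpha> \<and>\<^sub>f \<beta>) xs = 0" using assms
  proof (induction xs arbitrary: p \<alpha> q \<beta>)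
    case Nil
    then show ?case by (cases "p = 0") (auto simp: homogeneous_def)
  next
    case (Cons x xs)
    have A: "(contract x \<alpha> \<and>\<^sub>f \<beta>) xs = 0"
    proof (cases p)
      case 0
      then show ?thesis using Cons.prems by (simp add: homogeneous_0_contract)
    next
      case (Suc p')
      then show ?thesis
        using Cons.IH[of p' q "contract x \<alpha>" \<beta>] Cons.prems homogeneous_contract by fastforce
    qed
    have B: "(\<alpha> \<and>\<^sub>f contract x \<beta>) xs = 0"
    proof (cases q)
      case 0
      then show ?thesis using Cons.prems by (simp add: homogeneous_0_contract)
    next
      case (Suc q')
      then show ?thesis
        using Cons.IH[of p q' \<alpha> "contract x \<beta>"] Cons.prems homogeneous_contract by fastforce
    qed
    show ?case
      unfolding wedge_Cons homogeneous_parity_twist[OF Cons.prems(2)] wedge_fscale_left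
      by (simp add: fscale_def A B)
  qed
qed

lemma wedge_1_anticommute:
  assumes "homogeneous 1 \<mu>" "homogeneous 1 \<nu>"
  shows "\<mu> \<and>\<^sub>f \<nu> = - (\<nu> \<and>\<^sub>f \<mu>)"
  using wedge_graded_commute[OF assms] by (simp add: fscale_minus_one)

lemma wedge_2_commute:
  assumes "homogeneous 2 \<alpha>" "homogeneous 2 \<beta>"
  shows "\<alpha> \<and>\<^sub>f \<beta> = \<beta> \<and>\<^sub>f \<alpha>"
  using wedge_graded_commute[OF assms] by simp

lemma wedge_1_self:
  assumes "homogeneous 1 \<mu>"
  shows "\<mu> \<and>\<^sub>f \<mu> = 0"
proof
  fix xs
  have "(\<mu> \<and>\<^sub>f \<mu>) xs = - (\<mu> \<and>\<^sub>f \<mu>) xs"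
    using wedge_1_anticommute[OF assms assms] by (metis uminus_apply)
  then show "(\<mu> \<and>\<^sub>f \<mu>) xs = 0 xs" by simp
qed

lemma conj_form_wedge: "conj_form (\<alpha> \<and>\<^sub>f \<beta>) = conj_form \<alpha> \<and>\<^sub>f conj_form \<beta>"
  by (simp add: conj_form_def wedge_def fun_eq_iff)

lemma wedge_unit_left [simp]: "unit_form \<and>\<^sub>f \<alpha> = \<alpha>"
proof
  fix xs show "(unit_form \<and>\<^sub>f \<alpha>) xs = \<alpha> xs"
  proof (induction xs arbitrary: \<alpha>)
    case (Cons x xs)
    have "contract x unit_form = 0" "parity_twist unit_form = (unit_form :: 'a form)"
      by (auto simp: contract_def parity_twist_def unit_form_def fun_eq_iff)
    then have "(unit_form \<and>\<^sub>f \<alpha>) (x # xs) = (unit_form \<and>\<^sub>f contract x \<alpha>) xs"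
      by (simp add: wedge_Cons)
    then show ?case by (simp add: Cons.IH) (simp add: contract_def)
  qed (simp add: unit_form_def)
qed

lemma conj_form_apply: "conj_form \<alpha> xs = cnj (\<alpha> xs)"
  by (simp add: conj_form_def)

lemma conj_form_fscale: "conj_form (fscale c \<alpha>) = fscale (cnj c) (conj_form \<alpha>)"
  by (simp add: conj_form_def fscale_def)

lemma conj_form_add: "conj_form (\<alpha> + \<beta>) = conj_form \<alpha> + conj_form \<beta>"
  by (simp add: conj_form_def fun_eq_iff)

lemma conj_form_zero: "conj_form 0 = 0"
  by (simp add: conj_form_def fun_eq_iff)

lemma conj_form_sum: "conj_form (\<Sum>i\<in>A. f i) = (\<Sum>i\<in>A. conj_form (f i))"
  by (induction A rule: infinite_finite_induct)
    (simp_all only: conj_form_add conj_form_zero sum.infinite sum.empty sum.insert simp_thms)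

lemma conj_form_conj_form [simp]: "conj_form (conj_form \<alpha>) = \<alpha>"
  by (simp add: conj_form_def)

lemma homogeneous_conj_form: "homogeneous n \<alpha> \<Longrightarrow> homogeneous n (conj_form \<alpha>)"
  by (simp add: homogeneous_def conj_form_def)

lemma wedge_list_Nil [simp]: "wedge_list [] = unit_form"
  by (simp add: wedge_list_def)

lemma wedge_list_Cons [simp]: "wedge_list (\<alpha> # \<alpha>s) = \<alpha> \<and>\<^sub>f wedge_list \<alpha>s"
  by (simp add: wedge_list_def)

section \<open>Non-vanishing of wedge products of one-forms\<close>

text \<open>
  A (1,0)-form and its conjugate are both real-linear, so a single vector cannot separate them. A complex
  combination of the contractions with \<open>e\<close> and \<open>\<i> e\<close> can: with the coefficients \<open>1/2\<close> and \<open>-\<i>/2\<close> it kills conjugates,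
  with \<open>1/2\<close> and \<open>\<i>/2\<close> it kills (1,0)-forms.
\<close>

definition mixed_contract :: "complex \<Rightarrow> 'v \<Rightarrow> complex \<Rightarrow> 'v \<Rightarrow> 'v form \<Rightarrow> 'v form" where
  "mixed_contract c x d y \<alpha> = fscale c (contract x \<alpha>) + fscale d (contract y \<alpha>)"

lemma mixed_contract_wedge_1:
  assumes "homogeneous 1 \<mu>"
  shows "mixed_contract c x d y (\<mu> \<and>\<^sub>f \<beta>) =
    fscale (c * \<mu> [x] + d * \<mu> [y]) \<beta> - \<mu> \<and>\<^sub>f mixed_contract c x d y \<beta>"
proof -
  have "contract z \<mu> = fscale (\<mu> [z]) unit_form" for z
    using assms by (auto simp: homogeneous_def contract_def fscale_def unit_form_def fun_eq_iff)
  moreover have "parity_twist \<mu> = - \<mu>"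
    using homogeneous_parity_twist[OF assms] by (simp add: fscale_minus_one)
  ultimately have *: "contract z (\<mu> \<and>\<^sub>f \<beta>) = fscale (\<mu> [z]) \<beta> - \<mu> \<and>\<^sub>f contract z \<beta>" for z
    unfolding contract_wedge by (simp add: wedge_fscale_left wedge_minus_left)
  show ?thesis
    unfolding mixed_contract_def wedge_add_right wedge_fscale_right *
    by (simp add: fscale_def fun_eq_iff algebra_simps)
qed

lemma mixed_contract_wedge_list_eq_0:
  assumes "\<And>\<beta>. \<beta> \<in> set \<beta>s \<Longrightarrow> homogeneous 1 \<beta> \<and> c * \<beta> [x] + d * \<beta> [y] = 0"
  shows "mixed_contract c x d y (wedge_list \<beta>s) = 0"
  using assms
proof (induction \<beta>s)
  case Nil
  show ?case by (simp add: mixed_contract_def contract_def fscale_def unit_form_def fun_eq_iff)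
next
  case (Cons \<beta> \<beta>s)
  then have "homogeneous 1 \<beta>" "c * \<beta> [x] + d * \<beta> [y] = 0"
    "mixed_contract c x d y (wedge_list \<beta>s) = 0" by auto
  then show ?case
    unfolding wedge_list_Cons mixed_contract_wedge_1[OF \<open>homogeneous 1 \<beta>\<close>] by simp
qed

text \<open>
  An antiderivation that is 1 on the first factor and 0 on the others strips the first factor off. Applied
  repeatedly, this reduces a product of separated one-forms to the unit.
\<close>

lemma wedge_list_Cons_nonzero:
  assumes "homogeneous 1 \<alpha>" "c * \<alpha> [x] + d * \<alpha> [y] = 1"
    and "\<And>\<beta>. \<beta> \<in> set \<beta>s \<Longrightarrow> homogeneous 1 \<beta> \<and> c * \<beta> [x] + d * \<beta> [y] = 0"
    and "wedge_list \<beta>s \<noteq> 0"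
  shows "wedge_list (\<alpha> # \<beta>s) \<noteq> 0"
proof
  assume "wedge_list (\<alpha> # \<beta>s) = 0"
  then have "mixed_contract c x d y (wedge_list (\<alpha> # \<beta>s)) = 0"
    by (simp add: mixed_contract_def contract_def fscale_def fun_eq_iff)
  then have "wedge_list \<beta>s = 0"
    unfolding wedge_list_Cons mixed_contract_wedge_1[OF assms(1)] assms(2)
    by (simp add: mixed_contract_wedge_list_eq_0[OF assms(3)])
  with assms(4) show False by simp
qed

section \<open>Dual vectors of a basis of the (1,0)-forms\<close>

lemma Lambda10_homogeneous: "\<mu> \<in> Lambda10 scale \<Longrightarrow> homogeneous 1 \<mu>"
  by (simp add: Lambda10_def homogeneous_def)

lemma Lambda10_add: "\<mu> \<in> Lambda10 scale \<Longrightarrow> \<mu> [x + y] = \<mu> [x] + \<mu> [y]"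
  by (simp add: Lambda10_def Vector_Spaces.linear_iff)

lemma Lambda10_scale: "\<mu> \<in> Lambda10 scale \<Longrightarrow> \<mu> [scale c x] = c * \<mu> [x]"
  by (simp add: Lambda10_def Vector_Spaces.linear_iff)

lemma Lambda10_diff_fscale:
  assumes "\<mu> \<in> Lambda10 scale" "\<nu> \<in> Lambda10 scale"
  shows "\<mu> - fscale c \<nu> \<in> Lambda10 scale"
  using assms by (auto simp: Lambda10_def Vector_Spaces.linear_iff fscale_def algebra_simps)

text \<open>
  The classical kernel criterion, by induction on \<open>S\<close>. If \<open>\<nu>\<close> is non-zero at some \<open>x\<^sub>0\<close> in the common kernel of \<open>S\<close>,
  then subtracting the multiple of \<open>\<nu>\<close> that agrees with \<open>\<mu>\<close> at \<open>x\<^sub>0\<close> leaves a functional that vanishes on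
  the whole common kernel of \<open>S\<close>; otherwise \<open>\<nu>\<close> imposes no condition beyond \<open>S\<close>.
\<close>

lemma form_span_of_common_kernel:
  assumes "finite S" "S \<subseteq> Lambda10 scale" "\<mu> \<in> Lambda10 scale"
    and "\<And>x. (\<forall>\<nu>\<in>S. \<nu> [x] = 0) \<Longrightarrow> \<mu> [x] = 0"
  shows "\<mu> \<in> form_span S"
  using assms
proof (induction S arbitrary: \<mu> rule: finite_induct)
  case empty
  have "\<mu> xs = 0" for xs
  proof (cases "length xs = 1")
    case True
    then obtain x where "xs = [x]" by (auto simp: length_Suc_conv)
    then show ?thesis using empty.prems(3) by simp
  next
    case False
    then show ?thesis using empty.prems(2) by (simp add: Lambda10_def)
  qed
  then have "\<mu> = 0" by (simp add: fun_eq_iff)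
  then show ?case using form.span_zero by metis
next
  case (insert \<nu> S)
  have \<nu>: "\<nu> \<in> Lambda10 scale" and S: "S \<subseteq> Lambda10 scale" using insert.prems(1) by auto
  show ?case
  proof (cases "\<exists>x. (\<forall>\<kappa>\<in>S. \<kappa> [x] = 0) \<and> \<nu> [x] \<noteq> 0")
    case True
    then obtain x0 where x0: "\<forall>\<kappa>\<in>S. \<kappa> [x0] = 0" "\<nu> [x0] \<noteq> 0" by blast
    define c where "c = \<mu> [x0] / \<nu> [x0]"
    have "\<mu> - fscale c \<nu> \<in> form_span S"
    proof (rule insert.IH[OF S])
      show "\<mu> - fscale c \<nu> \<in> Lambda10 scale"
        using insert.prems(2) \<nu> by (rule Lambda10_diff_fscale)
      fix x assume x: "\<forall>\<kappa>\<in>S. \<kappa> [x] = 0"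
      \<comment> \<open>the projection of \<open>x\<close> along \<open>x\<^sub>0\<close> to the kernel of \<open>\<nu>\<close>\<close>
      define y where "y = x + scale (- (\<nu> [x] / \<nu> [x0])) x0"
      have y: "\<kappa> [y] = \<kappa> [x] - \<nu> [x] / \<nu> [x0] * \<kappa> [x0]" if "\<kappa> \<in> Lambda10 scale" for \<kappa>
        by (simp add: y_def Lambda10_add[OF that] Lambda10_scale[OF that])
      have "\<nu> [y] = 0" using y[OF \<nu>] x0(2) by simp
      moreover have "\<kappa> [y] = 0" if "\<kappa> \<in> S" for \<kappa>
      proof -
        have "\<kappa> \<in> Lambda10 scale" "\<kappa> [x] = 0" "\<kappa> [x0] = 0" using x x0(1) S that by auto
        then show ?thesis using y[of \<kappa>] by simp
      qed
      ultimately have "\<forall>\<kappa>\<in>insert \<nu> S. \<kappa> [y] = 0" by blast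
      then have "\<mu> [y] = 0" by (rule insert.prems(3))
      then show "(\<mu> - fscale c \<nu>) [x] = 0"
        using y[OF insert.prems(2)] by (simp add: fscale_def c_def)
    qed
    then have "(\<mu> - fscale c \<nu>) + fscale c \<nu> \<in> form_span (insert \<nu> S)"
      by (meson form.span_add form.span_scale form.span_base form.span_mono insertI1 subset_insertI subsetD)
    then show ?thesis by simp
  next
    case False
    then have "\<mu> \<in> form_span S"
      using insert.prems by (intro insert.IH[OF S]) auto
    then show ?thesis by (meson form.span_mono subset_insertI subsetD)
  qed
qed

lemma Lambda10_basis_mem:
  assumes "Lambda10_basis scale \<omega>" "i \<in> {1..4}"
  shows "\<omega> i \<in> Lambda10 scale"
  using assms form.span_base[of "\<omega> i" "\<omega> ` {1..4}"] by (auto simp: Lambda10_basis_def)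

lemma Lambda10_basis_homogeneous:
  assumes "Lambda10_basis scale \<omega>"
  shows "\<forall>i\<in>{1..4}. homogeneous 1 (\<omega> i)"
  using Lambda10_homogeneous Lambda10_basis_mem[OF assms] by blast

lemma Lambda10_basis_expand:
  assumes "Lambda10_basis scale \<omega>" "\<mu> \<in> Lambda10 scale"
  obtains x where "\<mu> = (\<Sum>i=1..4. fscale (x i) (\<omega> i))"
proof -
  have "\<mu> \<in> range (\<lambda>u. \<Sum>\<nu>\<in>\<omega> ` {1..4}. fscale (u \<nu>) \<nu>)" and inj: "inj_on \<omega> {1..4}"
    using assms form.span_finite[of "\<omega> ` {1..4}"] by (auto simp: Lambda10_basis_def)
  then obtain u where "\<mu> = (\<Sum>\<nu>\<in>\<omega> ` {1..4}. fscale (u \<nu>) \<nu>)" by blast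
  then have "\<mu> = (\<Sum>i=1..4. fscale (u (\<omega> i)) (\<omega> i))"
    by (simp only: sum.reindex[OF inj] o_def)
  then show ?thesis by (rule that)
qed

lemma Lambda10_basis_combination:
  assumes "Lambda10_basis scale \<omega>"
  shows "(\<Sum>i=1..4. fscale (x i) (\<omega> i)) \<in> Lambda10 scale"
proof -
  have "(\<Sum>i=1..4. fscale (x i) (\<omega> i)) \<in> form_span (\<omega> ` {1..4})"
    by (intro form.span_sum form.span_scale form.span_base imageI)
  then show ?thesis using assms by (simp only: Lambda10_basis_def)
qed

text \<open>
  By independence \<open>\<omega> i\<close> is not in the span of the other basis forms, so the kernel criterion yields a vector
  that they annihilate and \<open>\<omega> i\<close> does not.
\<close>

lemma dual_vector:
  assumes \<omega>: "Lambda10_basis scale \<omega>" and i: "i \<in> {1..4}"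
  obtains e where "\<And>j. j \<in> {1..4} \<Longrightarrow> \<omega> j [e] = (if j = i then 1 else 0)"
proof -
  let ?S = "\<omega> ` {1..4} - {\<omega> i}"
  have "\<omega> i \<notin> form_span ?S"
    using \<omega> i by (auto simp: Lambda10_basis_def form.dependent_def)
  moreover have "?S \<subseteq> Lambda10 scale" using Lambda10_basis_mem[OF \<omega>] by auto
  ultimately obtain x where x: "\<forall>\<nu>\<in>?S. \<nu> [x] = 0" "\<omega> i [x] \<noteq> 0"
    using form_span_of_common_kernel[of ?S scale "\<omega> i"]
      Lambda10_basis_mem[OF \<omega> i] by auto
  show thesis
  proof (rule that[of "scale (1 / \<omega> i [x]) x"])
    fix j :: nat assume j: "j \<in> {1..4}"
    have "\<omega> j [x] = 0" if "j \<noteq> i"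
      using x(1) j i that \<omega> by (auto simp: Lambda10_basis_def inj_on_def)
    then show "\<omega> j [scale (1 / \<omega> i [x]) x] = (if j = i then 1 else 0)"
      using x(2) by (simp add: Lambda10_scale[OF Lambda10_basis_mem[OF \<omega> j]])
  qed
qed

text \<open>
  The dual vectors \<open>e\<^sub>i\<close> and their multiples \<open>\<i> e\<^sub>i\<close> provide mixed contractions that strip off the eight factors
  one after the other.
\<close>

lemma Vol_nonzero:
  assumes \<omega>: "Lambda10_basis scale \<omega>"
  shows "Vol \<omega> \<noteq> 0"
proof -
  have "\<exists>e. \<forall>j\<in>{1..4}. \<omega> j [e] = (if j = i then 1 else 0)" if "i \<in> {1..4}" for i
    using dual_vector[OF \<omega> that] by metis
  then obtain e where e: "\<And>i j. i \<in> {1..4} \<Longrightarrow> j \<in> {1..4} \<Longrightarrow> \<omega> j [e i] = (if j = i then 1 else 0)"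
    by metis
  note mem = Lambda10_basis_mem[OF \<omega>]
  have h: "homogeneous 1 (\<omega> j)" "homogeneous 1 (conj_form (\<omega> j))" if "j \<in> {1..4}" for j
    using Lambda10_homogeneous[OF mem[OF that]] homogeneous_conj_form by auto
  have ie: "\<omega> j [scale \<i> (e i)] = (if j = i then \<i> else 0)" if "i \<in> {1..4}" "j \<in> {1..4}" for i j
    using e[OF that] by (simp add: Lambda10_scale[OF mem[OF that(2)]])
  have step: "wedge_list (\<omega> i # map \<omega> js @ map (\<lambda>j. conj_form (\<omega> j)) ks) \<noteq> 0"
    if "i \<in> {1..4}" "set js \<subseteq> {1..4} - {i}" "set ks \<subseteq> {1..4}"
      "wedge_list (map \<omega> js @ map (\<lambda>j. conj_form (\<omega> j)) ks) \<noteq> 0" for i js ks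
    using that
    by (intro wedge_list_Cons_nonzero[where x = "e i" and y = "scale \<i> (e i)" and c = "1/2" and d = "-\<i>/2"])
      (auto simp: h e ie subset_iff conj_form_apply simp del: One_nat_def)
  have step': "wedge_list (conj_form (\<omega> i) # map (\<lambda>j. conj_form (\<omega> j)) ks) \<noteq> 0"
    if "i \<in> {1..4}" "set ks \<subseteq> {1..4} - {i}" "wedge_list (map (\<lambda>j. conj_form (\<omega> j)) ks) \<noteq> 0" for i ks
    using that
    by (intro wedge_list_Cons_nonzero[where x = "e i" and y = "scale \<i> (e i)" and c = "1/2" and d = "\<i>/2"])
      (auto simp: h e ie subset_iff conj_form_apply simp del: One_nat_def)
  have "unit_form \<noteq> (0 :: 'a form)"
    by (metis unit_form_def zero_fun_apply zero_neq_one)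
  then have "wedge_list (map (\<lambda>j. conj_form (\<omega> j)) [1, 2, 3, 4]) \<noteq> 0"
    using step'[of 4 "[]"] step'[of 3 "[4]"] step'[of 2 "[3, 4]"] step'[of 1 "[2, 3, 4]"] by simp
  then have "wedge_list (map \<omega> [1, 2, 3, 4] @ map (\<lambda>j. conj_form (\<omega> j)) [1, 2, 3, 4]) \<noteq> 0"
    using step[of 4 "[]" "[1, 2, 3, 4]"] step[of 3 "[4]" "[1, 2, 3, 4]"]
      step[of 2 "[3, 4]" "[1, 2, 3, 4]"] step[of 1 "[2, 3, 4]" "[1, 2, 3, 4]"] by simp
  then show ?thesis by (simp add: Vol_def)
qed

section \<open>Decomposable (2,0)-forms and the Klein quadric\<close>

text \<open>The Klein quadric; with the sign of \<open>\<phi>\<^sup>5\<close> the Pluecker relation has no minus sign.\<close>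

definition klein :: "(nat \<Rightarrow> complex) \<Rightarrow> bool" where
  "klein c \<longleftrightarrow> c 1 * c 6 + c 2 * c 5 + c 3 * c 4 = 0"

text \<open>
  The 2x2 minors of the matrix with rows \<open>x\<close> and \<open>y\<close>, which are the coordinates of a decomposable (2,0)-form; the
  minor at 5 has its columns exchanged, in accordance with \<open>\<phi>\<^sup>5 = - \<omega>\<^sup>2 \<and> \<omega>\<^sup>4\<close>.
\<close>

definition pluecker :: "(nat \<Rightarrow> complex) \<Rightarrow> (nat \<Rightarrow> complex) \<Rightarrow> nat \<Rightarrow> complex" where
  "pluecker x y p =
     (if p = 1 then x 1 * y 2 - x 2 * y 1
      else if p = 2 then x 1 * y 3 - x 3 * y 1
      else if p = 3 then x 1 * y 4 - x 4 * y 1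
      else if p = 4 then x 2 * y 3 - x 3 * y 2
      else if p = 5 then x 4 * y 2 - x 2 * y 4
      else if p = 6 then x 3 * y 4 - x 4 * y 3
      else 0)"

lemma sum_1_4: "(\<Sum>i=1..4::nat. f i) = f 1 + f 2 + f 3 + f 4"
  by (simp add: eval_nat_numeral add.assoc)

lemma sum_1_6: "(\<Sum>i=1..6::nat. f i) = f 1 + f 2 + f 3 + f 4 + f 5 + f 6"
  by (simp add: eval_nat_numeral add.assoc)

lemma atLeastAtMost_1_6: "{1..6::nat} = {1, 2, 3, 4, 5, 6}"
  by auto

lemma klein_pluecker: "klein (pluecker x y)"
  by (simp add: klein_def pluecker_def algebra_simps)

text \<open>
  A point of the Klein quadric determines a skew-symmetric 4x4 matrix, which has rank at most two by the
  Pluecker relation. Two rows \<open>r\<^sub>i\<close>, \<open>r\<^sub>j\<close> that meet in a non-zero entry span its row space, and their minors are the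
  coordinates of the point multiplied by that entry.
\<close>

lemma klein_imp_pluecker:
  assumes "klein c"
  shows "\<exists>x y. \<forall>p\<in>{1..6}. c p = pluecker x y p"
proof -
  have witness: ?thesis
    if "a \<noteq> 0" "\<And>p. p \<in> {1..6} \<Longrightarrow> a * c p = pluecker x y p" for a x y
  proof (intro exI ballI)
    fix p :: nat assume "p \<in> {1..6}"
    then have "a * c p = pluecker x y p" by (rule that(2))
    moreover have "pluecker x (\<lambda>i. y i / a) p = pluecker x y p / a"
      by (simp add: pluecker_def diff_divide_distrib)
    ultimately have "a * c p = a * pluecker x (\<lambda>i. y i / a) p" using that(1) by simp
    then show "c p = pluecker x (\<lambda>i. y i / a) p" using that(1) by simp
  qed
  \<comment> \<open>the rows of the skew-symmetric matrix\<close>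
  define r1 where "r1 = (\<lambda>_::nat. 0)(2 := c 1, 3 := c 2, 4 := c 3)"
  define r2 where "r2 = (\<lambda>_::nat. 0)(1 := - c 1, 3 := c 4, 4 := - c 5)"
  define r3 where "r3 = (\<lambda>_::nat. 0)(1 := - c 2, 2 := - c 4, 4 := c 6)"
  define r4 where "r4 = (\<lambda>_::nat. 0)(1 := - c 3, 2 := c 5, 3 := - c 6)"
  note minor_simps = r1_def r2_def r3_def r4_def pluecker_def mult.commute
  \<comment> \<open>Five of the six minors are immediate; the one complementary to the chosen entry is the Pluecker relation.\<close>
  have solved: "c 1 * c 6 = - (c 2 * c 5) - c 3 * c 4" "c 2 * c 5 = - (c 1 * c 6) - c 3 * c 4"
    "c 3 * c 4 = - (c 1 * c 6) - c 2 * c 5"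
    using assms unfolding klein_def by algebra+
  have minor1: "c 1 * c p = pluecker r1 r2 p" if "p \<in> {1..6}" for p
    using that unfolding atLeastAtMost_1_6
    by (elim insertE emptyE) (simp_all add: minor_simps solved(1) del: One_nat_def)
  have minor2: "c 2 * c p = pluecker r1 r3 p" if "p \<in> {1..6}" for p
    using that unfolding atLeastAtMost_1_6
    by (elim insertE emptyE) (simp_all add: minor_simps solved(2) del: One_nat_def)
  have minor3: "c 3 * c p = pluecker r1 r4 p" if "p \<in> {1..6}" for p
    using that unfolding atLeastAtMost_1_6
    by (elim insertE emptyE) (simp_all add: minor_simps solved(3) del: One_nat_def)
  have minor4: "c 4 * c p = pluecker r2 r3 p" if "p \<in> {1..6}" for p
    using that unfolding atLeastAtMost_1_6
    by (elim insertE emptyE) (simp_all add: minor_simps solved(3) del: One_nat_def)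
  have minor5: "c 5 * c p = pluecker r4 r2 p" if "p \<in> {1..6}" for p
    using that unfolding atLeastAtMost_1_6
    by (elim insertE emptyE) (simp_all add: minor_simps solved(2) del: One_nat_def)
  have minor6: "c 6 * c p = pluecker r3 r4 p" if "p \<in> {1..6}" for p
    using that unfolding atLeastAtMost_1_6
    by (elim insertE emptyE) (simp_all add: minor_simps solved(1) del: One_nat_def)
  show ?thesis
  proof (cases "\<forall>p\<in>{1..6}. c p = 0")
    case True
    then have "\<forall>p\<in>{1..6}. c p = pluecker (\<lambda>_. 0) (\<lambda>_. 0) p" by (simp add: pluecker_def)
    then show ?thesis by blast
  next
    case False
    then consider "c 1 \<noteq> 0" | "c 2 \<noteq> 0" | "c 3 \<noteq> 0" | "c 4 \<noteq> 0" | "c 5 \<noteq> 0" | "c 6 \<noteq> 0"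
      unfolding atLeastAtMost_1_6 by blast
    then show ?thesis
    proof cases
      case 1
      then show ?thesis using minor1 by (rule witness)
    next
      case 2
      then show ?thesis using minor2 by (rule witness)
    next
      case 3
      then show ?thesis using minor3 by (rule witness)
    next
      case 4
      then show ?thesis using minor4 by (rule witness)
    next
      case 5
      then show ?thesis using minor5 by (rule witness)
    next
      case 6
      then show ?thesis using minor6 by (rule witness)
    qed
  qed
qed

lemma wedge_pluecker:
  assumes "\<forall>i\<in>{1..4}. homogeneous 1 (\<omega> i)"
  shows "(\<Sum>i=1..4. fscale (x i) (\<omega> i)) \<and>\<^sub>f (\<Sum>i=1..4. fscale (y i) (\<omega> i)) =
    (\<Sum>p=1..6. fscale (pluecker x y p) (phi \<omega> p))"
proof -
  have h: "homogeneous 1 (\<omega> 1)" "homogeneous 1 (\<omega> 2)" "homogeneous 1 (\<omega> 3)" "homogeneous 1 (\<omega> 4)"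
    using assms by simp_all
  note rules = h[THEN wedge_1_self]
    wedge_1_anticommute[OF h(2) h(1)] wedge_1_anticommute[OF h(3) h(1)]
    wedge_1_anticommute[OF h(4) h(1)] wedge_1_anticommute[OF h(3) h(2)]
    wedge_1_anticommute[OF h(4) h(2)] wedge_1_anticommute[OF h(4) h(3)]
  show ?thesis
    unfolding sum_1_4 sum_1_6 wedge_add_left wedge_add_right wedge_fscale_left wedge_fscale_right rules
    by (rule ext) (simp add: pluecker_def phi_def fscale_def algebra_simps)
qed

text \<open>
  The indices \<open>p\<close> and \<open>7 - p\<close> belong to complementary pairs among 1, 2, 3, 4, and the sign of \<open>\<phi>\<^sup>5\<close> makes the three
  products agree; all other products repeat a factor.
\<close>

lemma phi_wedge_phi:
  assumes "\<forall>i\<in>{1..4}. homogeneous 1 (\<omega> i)" "p \<in> {1..6}" "q \<in> {1..6}"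
  shows "phi \<omega> p \<and>\<^sub>f phi \<omega> q = (if q = 7 - p then \<omega> 1 \<and>\<^sub>f \<omega> 2 \<and>\<^sub>f \<omega> 3 \<and>\<^sub>f \<omega> 4 else 0)"
proof -
  have h: "homogeneous 1 (\<omega> 1)" "homogeneous 1 (\<omega> 2)" "homogeneous 1 (\<omega> 3)" "homogeneous 1 (\<omega> 4)"
    using assms(1) by simp_all
  have self: "\<mu> \<and>\<^sub>f \<mu> \<and>\<^sub>f \<beta> = 0" if "homogeneous 1 \<mu>" for \<mu> \<beta> :: "'a form"
    by (simp add: wedge_1_self[OF that] flip: wedge_assoc)
  have anti: "\<nu> \<and>\<^sub>f \<mu> \<and>\<^sub>f \<beta> = - (\<mu> \<and>\<^sub>f \<nu> \<and>\<^sub>f \<beta>)"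
    if "homogeneous 1 \<nu>" "homogeneous 1 \<mu>" for \<mu> \<nu> \<beta> :: "'a form"
    using wedge_1_anticommute[OF that] by (metis wedge_assoc wedge_minus_left)
  note rules = h[THEN wedge_1_self] h[THEN self]
    wedge_1_anticommute[OF h(2) h(1)] wedge_1_anticommute[OF h(3) h(1)]
    wedge_1_anticommute[OF h(4) h(1)] wedge_1_anticommute[OF h(3) h(2)]
    wedge_1_anticommute[OF h(4) h(2)] wedge_1_anticommute[OF h(4) h(3)]
    anti[OF h(2) h(1)] anti[OF h(3) h(1)] anti[OF h(4) h(1)] anti[OF h(3) h(2)]
    anti[OF h(4) h(2)] anti[OF h(4) h(3)]
  show ?thesis
    using assms(2,3) unfolding atLeastAtMost_1_6
    by (elim insertE emptyE)
      (simp_all add: phi_def rules wedge_assoc wedge_minus_left wedge_minus_right del: One_nat_def)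
qed


section \<open>Weak positivity as non-negativity on the Klein quadric\<close>

definition klein_hermitian :: "(nat \<Rightarrow> nat \<Rightarrow> complex) \<Rightarrow> (nat \<Rightarrow> complex) \<Rightarrow> complex" where
  "klein_hermitian a b = (\<Sum>p=1..6. \<Sum>q=1..6. a p q * b p * cnj (b q))"

lemma phi_wedge_combination:
  assumes "\<forall>i\<in>{1..4}. homogeneous 1 (\<omega> i)" "p \<in> {1..6}"
  shows "phi \<omega> p \<and>\<^sub>f (\<Sum>q=1..6. fscale (c q) (phi \<omega> q)) =
    fscale (c (7 - p)) (\<omega> 1 \<and>\<^sub>f \<omega> 2 \<and>\<^sub>f \<omega> 3 \<and>\<^sub>f \<omega> 4)"
proof -
  have "phi \<omega> p \<and>\<^sub>f (\<Sum>q=1..6. fscale (c q) (phi \<omega> q)) =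
      (\<Sum>q=1..6. if q = 7 - p then fscale (c q) (\<omega> 1 \<and>\<^sub>f \<omega> 2 \<and>\<^sub>f \<omega> 3 \<and>\<^sub>f \<omega> 4) else 0)"
    unfolding wedge_sum_right wedge_fscale_right
    by (rule sum.cong) (simp_all only: phi_wedge_phi[OF assms] if_distrib[of "fscale _"] form.scale_zero_right)
  also have "\<dots> = fscale (c (7 - p)) (\<omega> 1 \<and>\<^sub>f \<omega> 2 \<and>\<^sub>f \<omega> 3 \<and>\<^sub>f \<omega> 4)"
    using assms(2) by (subst sum.delta) auto
  finally show ?thesis .
qed

lemma phi_homogeneous:
  assumes "\<forall>i\<in>{1..4}. homogeneous 1 (\<omega> i)"
  shows "homogeneous 2 (phi \<omega> p)"
proof -
  have "homogeneous 2 (\<omega> i \<and>\<^sub>f \<omega> j)" if "i \<in> {1..4}" "j \<in> {1..4}" for i j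
    using homogeneous_wedge[of 1 "\<omega> i" 1 "\<omega> j"] assms that by (simp add: numeral_2_eq_2)
  moreover have "homogeneous 2 (- \<alpha>)" if "homogeneous 2 \<alpha>" for \<alpha> :: "'a form"
    using that by (simp add: homogeneous_def)
  ultimately show ?thesis
    by (simp add: phi_def) (simp add: homogeneous_def)
qed

lemma Vol_eq:
  "(\<omega> 1 \<and>\<^sub>f \<omega> 2 \<and>\<^sub>f \<omega> 3 \<and>\<^sub>f \<omega> 4) \<and>\<^sub>f conj_form (\<omega> 1 \<and>\<^sub>f \<omega> 2 \<and>\<^sub>f \<omega> 3 \<and>\<^sub>f \<omega> 4) = Vol \<omega>"
  by (simp only: Vol_def conj_form_wedge wedge_assoc)

text \<open>
  Moving \<open>\<psi>\<close> past the two-form \<open>conj_form (\<phi>\<^sup>k)\<close> costs no sign and pairs \<open>\<psi>\<close> with \<open>\<phi>\<^sup>j\<close> and its conjugate with that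
  of \<open>\<phi>\<^sup>k\<close>. Each pairing picks out the coordinate of \<open>\<psi>\<close> with the complementary index.
\<close>

lemma form22_wedge_square:
  assumes h: "\<forall>i\<in>{1..4}. homogeneous 1 (\<omega> i)"
    and \<psi>: "\<psi> = (\<Sum>p=1..6. fscale (c p) (phi \<omega> p))" "homogeneous 2 \<psi>"
  shows "form22 \<omega> a \<and>\<^sub>f \<psi> \<and>\<^sub>f conj_form \<psi> = fscale (klein_hermitian a (\<lambda>p. c (7 - p))) (Vol \<omega>)"
proof -
  have "(phi \<omega> j \<and>\<^sub>f conj_form (phi \<omega> k)) \<and>\<^sub>f \<psi> \<and>\<^sub>f conj_form \<psi> =
      fscale (c (7 - j) * cnj (c (7 - k))) (Vol \<omega>)" if "j \<in> {1..6}" "k \<in> {1..6}" for j k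
  proof -
    have "(phi \<omega> j \<and>\<^sub>f conj_form (phi \<omega> k)) \<and>\<^sub>f \<psi> \<and>\<^sub>f conj_form \<psi> =
        phi \<omega> j \<and>\<^sub>f (conj_form (phi \<omega> k) \<and>\<^sub>f \<psi>) \<and>\<^sub>f conj_form \<psi>"
      by (simp only: wedge_assoc)
    also have "conj_form (phi \<omega> k) \<and>\<^sub>f \<psi> = \<psi> \<and>\<^sub>f conj_form (phi \<omega> k)"
      by (intro wedge_2_commute homogeneous_conj_form phi_homogeneous h \<psi>(2))
    also have "phi \<omega> j \<and>\<^sub>f (\<psi> \<and>\<^sub>f conj_form (phi \<omega> k)) \<and>\<^sub>f conj_form \<psi> =
        (phi \<omega> j \<and>\<^sub>f \<psi>) \<and>\<^sub>f conj_form (phi \<omega> k \<and>\<^sub>f \<psi>)"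
      by (simp only: wedge_assoc conj_form_wedge)
    also have "\<dots> = fscale (c (7 - j) * cnj (c (7 - k))) (Vol \<omega>)"
      unfolding \<psi>(1) phi_wedge_combination[OF h that(1)] phi_wedge_combination[OF h that(2)]
        conj_form_fscale wedge_fscale_left wedge_fscale_right Vol_eq
      by (simp add: fscale_def mult.assoc mult.left_commute)
    finally show ?thesis .
  qed
  then have "form22 \<omega> a \<and>\<^sub>f \<psi> \<and>\<^sub>f conj_form \<psi> =
      (\<Sum>j=1..6. \<Sum>k=1..6. fscale (a j k) (fscale (c (7 - j) * cnj (c (7 - k))) (Vol \<omega>)))"
    unfolding form22_def wedge_sum_left wedge_fscale_left by (intro sum.cong refl) simp
  also have "\<dots> = fscale (klein_hermitian a (\<lambda>p. c (7 - p))) (Vol \<omega>)"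
    unfolding klein_hermitian_def form.scale_sum_left
    by (intro sum.cong refl) (simp add: fscale_def mult.assoc)
  finally show ?thesis .
qed

lemma decomposable20_iff:
  assumes \<omega>: "Lambda10_basis scale \<omega>"
  shows "\<psi> \<in> decomposable20 scale \<longleftrightarrow> (\<exists>c. klein c \<and> \<psi> = (\<Sum>p=1..6. fscale (c p) (phi \<omega> p)))"
proof
  assume "\<psi> \<in> decomposable20 scale"
  then obtain \<mu> \<nu> where \<mu>: "\<mu> \<in> Lambda10 scale" and \<nu>: "\<nu> \<in> Lambda10 scale" and \<psi>: "\<psi> = \<mu> \<and>\<^sub>f \<nu>"
    by (auto simp: decomposable20_def)
  obtain x where x: "\<mu> = (\<Sum>i=1..4. fscale (x i) (\<omega> i))" by (rule Lambda10_basis_expand[OF \<omega> \<mu>])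
  obtain y where y: "\<nu> = (\<Sum>i=1..4. fscale (y i) (\<omega> i))" by (rule Lambda10_basis_expand[OF \<omega> \<nu>])
  show "\<exists>c. klein c \<and> \<psi> = (\<Sum>p=1..6. fscale (c p) (phi \<omega> p))"
    unfolding \<psi> x y wedge_pluecker[OF Lambda10_basis_homogeneous[OF \<omega>]] using klein_pluecker by blast
next
  assume "\<exists>c. klein c \<and> \<psi> = (\<Sum>p=1..6. fscale (c p) (phi \<omega> p))"
  then obtain c where c: "klein c" and \<psi>: "\<psi> = (\<Sum>p=1..6. fscale (c p) (phi \<omega> p))" by blast
  from klein_imp_pluecker[OF c] obtain x y where xy: "\<forall>p\<in>{1..6}. c p = pluecker x y p" by blast
  have "\<psi> = (\<Sum>p=1..6. fscale (pluecker x y p) (phi \<omega> p))"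
    unfolding \<psi> by (intro sum.cong refl) (simp only: xy)
  then have "\<psi> = (\<Sum>i=1..4. fscale (x i) (\<omega> i)) \<and>\<^sub>f (\<Sum>i=1..4. fscale (y i) (\<omega> i))"
    by (simp only: wedge_pluecker[OF Lambda10_basis_homogeneous[OF \<omega>]])
  then show "\<psi> \<in> decomposable20 scale"
    unfolding decomposable20_def using Lambda10_basis_combination[OF \<omega>] by blast
qed

lemma conj_form_form22:
  assumes h: "\<forall>i\<in>{1..4}. homogeneous 1 (\<omega> i)"
    and a: "\<forall>p q. a q p = cnj (a p q)"
  shows "conj_form (form22 \<omega> a) = form22 \<omega> a"
proof -
  have cnj_a: "cnj (a p q) = a q p" for p q using a by metis
  have "conj_form (form22 \<omega> a) =
      (\<Sum>j=1..6. \<Sum>k=1..6. fscale (a k j) (conj_form (phi \<omega> j) \<and>\<^sub>f phi \<omega> k))"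
    unfolding form22_def conj_form_sum conj_form_fscale conj_form_wedge conj_form_conj_form
    by (simp only: cnj_a)
  also have "\<dots> = (\<Sum>j=1..6. \<Sum>k=1..6. fscale (a k j) (phi \<omega> k \<and>\<^sub>f conj_form (phi \<omega> j)))"
    by (simp only: wedge_2_commute[OF homogeneous_conj_form[OF phi_homogeneous[OF h]] phi_homogeneous[OF h]])
  also have "\<dots> = form22 \<omega> a"
    unfolding form22_def by (rule sum.swap)
  finally show ?thesis .
qed

lemma form22_mem_Lambda:
  assumes mem: "\<And>i. i \<in> {1..4} \<Longrightarrow> \<omega> i \<in> Lambda10 scale"
  shows "form22 \<omega> a \<in> Lambda scale 2 2"
proof -
  have w: "\<exists>\<mu>s. \<omega> i \<and>\<^sub>f \<omega> j = wedge_list \<mu>s \<and> length \<mu>s = 2 \<and> set \<mu>s \<subseteq> Lambda10 scale"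
    if "i \<in> {1..4}" "j \<in> {1..4}" for i j
    using mem[OF that(1)] mem[OF that(2)] by (intro exI[of _ "[\<omega> i, \<omega> j]"]) simp
  have phis: "\<exists>\<mu>s. phi \<omega> p = wedge_list \<mu>s \<and> length \<mu>s = 2 \<and> set \<mu>s \<subseteq> Lambda10 scale" if "p \<in> {1..6}" for p
  proof -
    have "- (\<omega> 2 \<and>\<^sub>f \<omega> 4) = \<omega> 4 \<and>\<^sub>f \<omega> 2"
      using wedge_1_anticommute[OF Lambda10_homogeneous[OF mem[of 4]] Lambda10_homogeneous[OF mem[of 2]]] by simp
    then show ?thesis
      using that w[of 1 2] w[of 1 3] w[of 1 4] w[of 2 3] w[of 4 2] w[of 3 4]
      unfolding atLeastAtMost_1_6 by (elim insertE emptyE) (simp_all add: phi_def)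
  qed
  have "phi \<omega> j \<and>\<^sub>f conj_form (phi \<omega> k) \<in> Lambda scale 2 2"
    if jk: "j \<in> {1..6}" "k \<in> {1..6}" for j k
  proof -
    obtain \<mu>s \<nu>s where
      "phi \<omega> j = wedge_list \<mu>s" "length \<mu>s = 2" "set \<mu>s \<subseteq> Lambda10 scale"
      "phi \<omega> k = wedge_list \<nu>s" "length \<nu>s = 2" "set \<nu>s \<subseteq> Lambda10 scale"
      using phis[OF jk(1)] phis[OF jk(2)] by metis
    then show ?thesis unfolding Lambda_def by (intro form.span_base) auto
  qed
  then show ?thesis
    unfolding form22_def Lambda_def by (intro form.span_sum form.span_scale) 
qed

text \<open>
  The passage \<open>b\<^sub>p = c\<^bsub>7-p\<^esub>\<close> from the coordinates of \<open>\<psi>\<close> to the argument of the sesquilinear form exchanges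
  the factors of each product in the Pluecker relation.
\<close>

lemma klein_reverse: "klein (\<lambda>p. c (7 - p)) \<longleftrightarrow> klein c"
  by (simp add: klein_def algebra_simps)

theorem weakly_positive_form22D:
  assumes \<omega>: "Lambda10_basis scale \<omega>" and pos: "weakly_positive scale \<omega> (form22 \<omega> a)" and b: "klein b"
  shows "0 \<le> klein_hermitian a b"
proof -
  note h = Lambda10_basis_homogeneous[OF \<omega>]
  define \<psi> where "\<psi> = (\<Sum>p=1..6. fscale (b (7 - p)) (phi \<omega> p))"
  have \<psi>: "\<psi> \<in> decomposable20 scale"
    unfolding decomposable20_iff[OF \<omega>] \<psi>_def using b klein_reverse[of b] by blast
  then have "homogeneous 2 \<psi>"
    using homogeneous_wedge[OF Lambda10_homogeneous Lambda10_homogeneous]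
    by (auto simp: decomposable20_def numeral_2_eq_2)
  note eq = form22_wedge_square[OF h \<psi>_def this, of a]
  have eq7: "klein_hermitian a (\<lambda>p. b (7 - (7 - p))) = klein_hermitian a b"
    unfolding klein_hermitian_def by (intro sum.cong refl) (simp add: numeral_eq_Suc)
  have "nonneg44 \<omega> (form22 \<omega> a \<and>\<^sub>f \<psi> \<and>\<^sub>f conj_form \<psi>)"
    using pos \<psi> unfolding weakly_positive_def by blast
  then obtain r :: real where "0 \<le> r"
    "fscale (klein_hermitian a b) (Vol \<omega>) = fscale (complex_of_real r) (Vol \<omega>)"
    unfolding nonneg44_def eq eq7 by blast
  then have "klein_hermitian a b = complex_of_real r"
    using Vol_nonzero[OF \<omega>] form.scale_right_imp_eq by blast
  then show ?thesis using \<open>0 \<le> r\<close> by (simp add: less_eq_complex_def)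
qed

theorem weakly_positive_form22I:
  assumes \<omega>: "Lambda10_basis scale \<omega>"
    and herm: "\<forall>p q. a q p = cnj (a p q)"
    and nonneg: "\<And>b. klein b \<Longrightarrow> 0 \<le> klein_hermitian a b"
  shows "weakly_positive scale \<omega> (form22 \<omega> a)"
proof -
  note mem = Lambda10_basis_mem[OF \<omega>]
  note h = Lambda10_basis_homogeneous[OF \<omega>]
  have "nonneg44 \<omega> (form22 \<omega> a \<and>\<^sub>f \<psi> \<and>\<^sub>f conj_form \<psi>)" if \<psi>: "\<psi> \<in> decomposable20 scale" for \<psi>
  proof -
    from \<psi> obtain c where c: "klein c" "\<psi> = (\<Sum>p=1..6. fscale (c p) (phi \<omega> p))"
      unfolding decomposable20_iff[OF \<omega>] by blast
    have hom: "homogeneous 2 \<psi>"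
      using \<psi> homogeneous_wedge[OF Lambda10_homogeneous Lambda10_homogeneous]
      by (auto simp: decomposable20_def numeral_2_eq_2)
    have "0 \<le> klein_hermitian a (\<lambda>p. c (7 - p))"
      using nonneg klein_reverse c(1) by blast
    then have "0 \<le> Re (klein_hermitian a (\<lambda>p. c (7 - p)))"
      "klein_hermitian a (\<lambda>p. c (7 - p)) = complex_of_real (Re (klein_hermitian a (\<lambda>p. c (7 - p))))"
      by (simp_all add: less_eq_complex_def complex_eq_iff)
    then show ?thesis
      unfolding nonneg44_def form22_wedge_square[OF h c(2) hom] by metis
  qed
  then show ?thesis
    unfolding weakly_positive_def
    using form22_mem_Lambda[of \<omega> scale a] mem conj_form_form22[OF h herm] by blast
qed

section \<open>The bound for anti-diagonal entries\<close>

lemma antidiag_cases: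
  assumes "(j, k) \<in> antidiag" "(l, m) \<in> antidiag" "(l, m) \<noteq> (j, k)"
  shows "distinct [j, k, l, m]" "{j, k, l, m} \<subseteq> {1..6}"
    and "(\<And>p. p \<notin> {j, k, l, m} \<Longrightarrow> b p = 0) \<Longrightarrow> klein b \<longleftrightarrow> b j * b k + b l * b m = 0"
  using assms by (auto simp: antidiag_def klein_def add.commute)

lemma klein_hermitian_support:
  assumes "S \<subseteq> {1..6}" "\<And>p. p \<notin> S \<Longrightarrow> b p = 0"
  shows "klein_hermitian a b = (\<Sum>p\<in>S. \<Sum>q\<in>S. a p q * b p * cnj (b q))"
proof -
  have *: "(\<Sum>q=1..6. a p q * b p * cnj (b q)) = (\<Sum>q\<in>S. a p q * b p * cnj (b q))" for p
    using assms by (intro sum.mono_neutral_right) auto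
  show ?thesis
    unfolding klein_hermitian_def * using assms by (intro sum.mono_neutral_right) auto
qed

text \<open>
  Averaging over fourth roots of unity \<open>t\<close>, rather than just over \<open>1\<close> and \<open>-1\<close>, also cancels the terms in
  \<open>t\<^sup>2\<close> and \<open>(cnj t)\<^sup>2\<close>, which carry \<open>a l m\<close> and \<open>a m l\<close>.
\<close>

lemma klein_hermitian_average:
  assumes pos: "\<And>b. klein b \<Longrightarrow> 0 \<le> klein_hermitian a b"
    and jk: "(j, k) \<in> antidiag" and lm: "(l, m) \<in> antidiag" "(l, m) \<noteq> (j, k)"
    and u: "cmod u = 1"
  shows "0 \<le> a j j + a k k + a l l + a m m + a j k * u + a k j * cnj u"
proof -
  note d = antidiag_cases[OF jk lm]
  define b where "b t = (\<lambda>_. 0)(j := u, k := 1, l := t, m := - u * cnj t)" for t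
  have b: "b t j = u" "b t k = 1" "b t l = t" "b t m = - u * cnj t" "\<And>p. p \<notin> {j, k, l, m} \<Longrightarrow> b t p = 0" for t
    using d(1) by (auto simp: b_def)
  have uu: "u * cnj u = 1" using u by (simp add: complex_norm_square[symmetric])
  define H where "H t = klein_hermitian a (b t)" for t
  have H: "H t = (\<Sum>p\<in>{j, k, l, m}. \<Sum>q\<in>{j, k, l, m}. a p q * b t p * cnj (b t q))" for t
    unfolding H_def by (rule klein_hermitian_support[OF d(2) b(5)])
  have "0 \<le> H t" if "t * cnj t = 1" for t
    unfolding H_def using d(3)[of "b t", OF b(5)] that by (intro pos) (simp add: b(1-4))
  then have "0 \<le> H 1 + H \<i> + H (- 1) + H (- \<i>)"
    by (intro add_nonneg_nonneg) simp_all
  also have "\<dots> = 4 * (a j j + a k k + a l l + a m m + a j k * u + a k j * cnj u)"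
  proof -
    have uu': "u * (cnj u * z) = z" "u * (w * (cnj u * z)) = w * z" for w z
      using uu by algebra+
    have H_eq: "H t = a j j + a k k + (a l l + a m m) * (t * cnj t) + a j k * u + a k j * cnj u
      + (a j l * u + a k l) * cnj t - (a j m + a k m * cnj u) * t
      + (a l j * cnj u + a l k) * t - (a m j + a m k * u) * cnj t
      - a l m * cnj u * (t * t) - a m l * u * (cnj t * cnj t)" for t
      unfolding H using d(1) by (simp add: b(1-4) uu uu' algebra_simps)
    show ?thesis unfolding H_eq by (simp add: algebra_simps)
  qed
  finally show ?thesis by (simp add: less_eq_complex_def)
qed

lemma klein_hermitian_diag:
  assumes pos: "\<And>b. klein b \<Longrightarrow> 0 \<le> klein_hermitian a b" and "p \<in> {1..6}"
  shows "0 \<le> a p p"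
proof -
  define b :: "nat \<Rightarrow> complex" where "b = (\<lambda>_. 0)(p := 1)"
  have "klein b" using assms(2) by (auto simp: klein_def b_def)
  moreover have "klein_hermitian a b = a p p"
    using assms(2) by (subst klein_hermitian_support[of "{p}"]) (auto simp: b_def)
  ultimately show ?thesis using pos by metis
qed

text \<open>
  The averaged inequality contains the statement that its right-hand side is real; the choices \<open>u = 1\<close> and \<open>u = \<i>\<close>
  turn this into \<open>a k j = cnj (a j k)\<close>. The bound then comes from the \<open>u\<close> for which \<open>a j k * u\<close> is real and negative.
\<close>

lemma antidiagonal_bound:
  assumes pos: "\<And>b. klein b \<Longrightarrow> 0 \<le> klein_hermitian a b"
    and jk: "(j, k) \<in> antidiag" and lm: "(l, m) \<in> antidiag" "(l, m) \<noteq> (j, k)"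
  shows "complex_of_real (cmod (a j k)) \<le> (a j j + a k k + a l l + a m m) / 2"
proof -
  define s where "s = a j j + a k k + a l l + a m m"
  have "0 \<le> s"
    unfolding s_def using antidiag_cases(2)[OF jk lm]
    by (intro add_nonneg_nonneg klein_hermitian_diag[OF pos]) auto
  then have s: "Im s = 0" "0 \<le> Re s" by (simp_all add: less_eq_complex_def)
  have avg: "0 \<le> s + a j k * u + a k j * cnj u" if "cmod u = 1" for u
    unfolding s_def using klein_hermitian_average[OF pos jk lm that] by simp
  have herm: "a k j = cnj (a j k)"
    using avg[of 1] avg[of \<i>] s by (simp add: less_eq_complex_def complex_eq_iff)
  have "2 * cmod (a j k) \<le> Re s"
  proof (cases "a j k = 0")
    case False
    define u where "u = - cnj (a j k) / cmod (a j k)"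
    have "cmod u = 1" using False by (simp add: u_def norm_divide)
    moreover have "a j k * u = - complex_of_real (cmod (a j k))"
      using False by (simp add: u_def complex_norm_square[symmetric] power2_eq_square)
    moreover from this have "a k j * cnj u = - complex_of_real (cmod (a j k))"
      unfolding herm by (metis complex_cnj_complex_of_real complex_cnj_minus complex_cnj_mult)
    ultimately show ?thesis using avg[of u] by (simp add: less_eq_complex_def)
  qed (use s in simp)
  then show ?thesis
    using s by (simp add: s_def less_eq_complex_def)
qed

section \<open>Sharpness\<close>

text \<open>
  The permutation matrix of the transposition of \<open>j\<close> and \<open>k\<close>. It has \<open>a j j = a k k = 0\<close> and
  \<open>a j k = a l l = a m m = 1\<close>, hence equality in the bound, for both choices of the pair \<open>(l, m)\<close>.
\<close>

definition swap_matrix :: "nat \<Rightarrow> nat \<Rightarrow> nat \<Rightarrow> nat \<Rightarrow> complex" where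
  "swap_matrix j k p q = (if q = (if p = j then k else if p = k then j else p) then 1 else 0)"

lemma swap_matrix_hermitian: "swap_matrix j k q p = cnj (swap_matrix j k p q)"
  by (auto simp: swap_matrix_def)

text \<open>
  The quadric bounds \<open>|x\<^sub>1 x\<^sub>2|\<close> by \<open>|y\<^sub>1 y\<^sub>2| + |z\<^sub>1 z\<^sub>2|\<close>, and \<open>2 |y\<^sub>1 y\<^sub>2| \<le> |y\<^sub>1|\<^sup>2 + |y\<^sub>2|\<^sup>2\<close>, likewise for \<open>z\<close>.
\<close>

lemma quadric_diagonal_dominates: 
  assumes "x1 * x2 + y1 * y2 + z1 * z2 = (0::complex)"
  shows "0 \<le> x1 * cnj x2 + x2 * cnj x1 + y1 * cnj y1 + y2 * cnj y2 + z1 * cnj z1 + z2 * cnj z2"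
proof -
  have "x1 * x2 = - (y1 * y2 + z1 * z2)" using assms by algebra
  then have "cmod x1 * cmod x2 \<le> cmod y1 * cmod y2 + cmod z1 * cmod z2"
    by (metis norm_minus_cancel norm_mult norm_triangle_ineq)
  moreover have "- (cmod x1 * cmod x2) \<le> Re (x1 * cnj x2)"
    using complex_Re_le_cmod[of "- (x1 * cnj x2)"] by (simp add: norm_mult)
  moreover have "2 * (cmod y * cmod y') \<le> (cmod y)\<^sup>2 + (cmod y')\<^sup>2" for y y'
    using sum_squares_bound[of "cmod y" "cmod y'"] by simp
  note this[of y1 y2] this[of z1 z2]
  ultimately have "0 \<le> 2 * Re (x1 * cnj x2) + (cmod y1)\<^sup>2 + (cmod y2)\<^sup>2 + (cmod z1)\<^sup>2 + (cmod z2)\<^sup>2"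
    by linarith
  then have "0 \<le> complex_of_real (2 * Re (x1 * cnj x2) + (cmod y1)\<^sup>2 + (cmod y2)\<^sup>2 + (cmod z1)\<^sup>2 + (cmod z2)\<^sup>2)"
    by (simp add: less_eq_complex_def)
  also have "\<dots> = x1 * cnj x2 + x2 * cnj x1 + y1 * cnj y1 + y2 * cnj y2 + z1 * cnj z1 + z2 * cnj z2"
    using complex_add_cnj[of "x1 * cnj x2"]
    unfolding of_real_add complex_norm_square by (simp add: mult.commute)
  finally show ?thesis .
qed

lemma swap_matrix_nonneg:
  assumes "(j, k) \<in> antidiag" "klein b"
  shows "0 \<le> klein_hermitian (swap_matrix j k) b"
proof -
  have row: "(\<Sum>q=1..6. swap_matrix j k p q * b p * cnj (b q)) =
      b p * cnj (b (if p = j then k else if p = k then j else p))" if "p \<in> {1..6}" for p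
  proof -
    have "(if p = j then k else if p = k then j else p) \<in> {1..6}"
      using assms(1) that by (auto simp: antidiag_def)
    then show ?thesis
      by (simp add: swap_matrix_def if_distrib[of "\<lambda>x. x * _"] sum.delta' cong: if_cong)
  qed
  have "klein_hermitian (swap_matrix j k) b =
      (\<Sum>p=1..6. b p * cnj (b (if p = j then k else if p = k then j else p)))"
    unfolding klein_hermitian_def using row by (intro sum.cong) auto
  also have "0 \<le> \<dots>"
  proof -
    from assms(1) consider "j = 1" "k = 6" | "j = 2" "k = 5" | "j = 3" "k = 4"
      by (auto simp: antidiag_def)
    then show ?thesis
    proof cases
      case 1
      show ?thesis
        using quadric_diagonal_dominates[of "b 1" "b 6" "b 2" "b 5" "b 3" "b 4"] assms(2)
        unfolding 1 sum_1_6 klein_def by (simp add: add_ac)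
    next
      case 2
      show ?thesis
        using quadric_diagonal_dominates[of "b 2" "b 5" "b 1" "b 6" "b 3" "b 4"] assms(2)
        unfolding 2 sum_1_6 klein_def by (simp add: add_ac)
    next
      case 3
      show ?thesis
        using quadric_diagonal_dominates[of "b 3" "b 4" "b 1" "b 6" "b 2" "b 5"] assms(2)
        unfolding 3 sum_1_6 klein_def by (simp add: add_ac)
    qed
  qed
  finally show ?thesis .
qed

theorem theorem2:
  fixes scale :: "complex \<Rightarrow> 'v::ab_group_add \<Rightarrow> 'v"
    and \<omega> :: "nat \<Rightarrow> 'v form"
  assumes "vector_space scale"
    and "vector_space.dim scale (UNIV :: 'v set) = 4"
    and "Lambda10_basis scale \<omega>"
  shows "(\<forall>\<Theta> a. weakly_positive scale \<omega> \<Theta> \<and> \<Theta> = form22 \<omega> a \<longrightarrow>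
            (\<forall>(j, k)\<in>antidiag. \<forall>(l, m)\<in>antidiag. (l, m) \<noteq> (j, k) \<longrightarrow>
               complex_of_real (cmod (a j k)) \<le> (a j j + a k k + a l l + a m m) / 2)) \<and>
         (\<forall>(j, k)\<in>antidiag. \<forall>(l, m)\<in>antidiag. (l, m) \<noteq> (j, k) \<longrightarrow>
            (\<exists>\<Theta> a. weakly_positive scale \<omega> \<Theta> \<and> \<Theta> = form22 \<omega> a \<and> a j k \<noteq> 0 \<and>
               complex_of_real (cmod (a j k)) = (a j j + a k k + a l l + a m m) / 2))"
proof (intro conjI)
  note \<omega> = assms(3)
  show "\<forall>\<Theta> a. weakly_positive scale \<omega> \<Theta> \<and> \<Theta> = form22 \<omega> a \<longrightarrow>
      (\<forall>(j, k)\<in>antidiag. \<forall>(l, m)\<in>antidiag. (l, m) \<noteq> (j, k) \<longrightarrow>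
         complex_of_real (cmod (a j k)) \<le> (a j j + a k k + a l l + a m m) / 2)"
    using antidiagonal_bound[OF weakly_positive_form22D[OF \<omega>]] by blast
  have "\<exists>\<Theta> a. weakly_positive scale \<omega> \<Theta> \<and> \<Theta> = form22 \<omega> a \<and> a j k \<noteq> 0 \<and>
      complex_of_real (cmod (a j k)) = (a j j + a k k + a l l + a m m) / 2"
    if jk: "(j, k) \<in> antidiag" and lm: "(l, m) \<in> antidiag" "(l, m) \<noteq> (j, k)" for j k l m
  proof (intro exI conjI)
    show "weakly_positive scale \<omega> (form22 \<omega> (swap_matrix j k))"
      using swap_matrix_hermitian swap_matrix_nonneg[OF jk]
      by (intro weakly_positive_form22I[OF \<omega>]) blast+
    show "swap_matrix j k j k \<noteq> 0"
      "complex_of_real (cmod (swap_matrix j k j k)) =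
        (swap_matrix j k j j + swap_matrix j k k k + swap_matrix j k l l + swap_matrix j k m m) / 2"
      using antidiag_cases(1)[OF jk lm] by (auto simp: swap_matrix_def)
  qed (rule refl)
  then show "\<forall>(j, k)\<in>antidiag. \<forall>(l, m)\<in>antidiag. (l, m) \<noteq> (j, k) \<longrightarrow>
      (\<exists>\<Theta> a. weakly_positive scale \<omega> \<Theta> \<and> \<Theta> = form22 \<omega> a \<and> a j k \<noteq> 0 \<and>
         complex_of_real (cmod (a j k)) = (a j j + a k k + a l l + a m m) / 2)"
    by blast
qed

end
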